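(* Let $r,s\ge1$ be integers, written as $r=p_1^{r_1}\cdots p_q^{r_q}$ and $s=p_1^{s_1}\cdots p_q^{s_q}$ with distinct primes $p_1,\ldots,p_q$ and exponents $r_i,s_i\ge0$. Define integers $a_1,a_2,a_3,b_1,b_2,b_3\ge1$ by $$a_1=\prod_{i:\,r_i>s_i}p_i^{r_i},\quad a_2=\prod_{i:\,r_i=s_i}p_i^{r_i},\quad a_3=\prod_{i:\,r_i<s_i}p_i^{r_i},$$ $$b_1=\prod_{i:\,r_i>s_i}p_i^{s_i},\quad b_2=\prod_{i:\,r_i=s_i}p_i^{s_i},\quad b_3=\prod_{i:\,r_i<s_i}p_i^{s_i}.$$ Then $r=a_1a_2a_3$, $s=b_1b_2b_3$; $(a_1,a_2)=(a_2,a_3)=(a_3,a_1)=1$; $(b_1,b_2)=(b_2,b_3)=(b_3,b_1)=1$; $b_1\mid a_1$ and $D^{\mathrm{pr}}(a_1)=D^{\mathrm{pr}}(a_1/b_1)$; $a_2=b_2$; $a_3\mid b_3$ and $D^{\mathrm{pr}}(b_3)=D^{\mathrm{pr}}(b_3/a_3)$. Suppose moreover that $R$ is a commutative $\mathbb{Q}$-algebra, and let $x,y\in Nr(R)$. Then $$(T_r(x)\cdot_{Nr}T_s(y))_{[r,s]}=\frac{1}{a_2}\sum_{d_2\mid a_2}\mu\Big(\frac{a_2}{d_2}\Big)\,(F_{a_3d_2}(x))_{a_1}\,(F_{b_1d_2}(y))_{b_3}.$$ In particular, when $a_2=b_2=1$, $$(T_r(x)\cdot_{Nr}T_s(y))_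{[r,s]}=(F_{a_3}(x))_{a_1}\,(F_{b_1}(y))_{b_3}.$$
   Context: $(i,j)$ and $[i,j]$ denote gcd and lcm; $\mu$ is the Möbius function; $D^{\mathrm{pr}}(n)$ is the set of prime divisors of $n$; empty products equal $1$. For a commutative ring $R$, the necklace ring $Nr(R)$ is the set of infinite vectors $(x_1,x_2,x_3,\ldots)$ with entries in $R$, with componentwise addition and multiplication $(x\cdot_{Nr}y)_n=\sum_{[i,j]=n}(i,j)x_iy_j$. The $n$-th entry of $x\in Nr(R)$ is denoted $x_n$ or $(x)_n$. For $r\ge1$, the truncated operation $T_r:Nr(R)\to Nr(R)$ is given by $(T_r(x))_n=x_n$ if $n\mid r$ and $0$ if $n\nmid r$; the $r$-th Frobenius operation $F_r:Nr(R)\to Nr(R)$ is given by $(F_r(x))_n=\sum_{j:\,[j,r]=nr}\frac{j}{n}x_j$ (here $j/n$ is always an integer). *)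

theory Defs
  imports Complex_Main "HOL-Computational_Algebra.Squarefree"
begin

definition moebius :: "nat \<Rightarrow> int" where
  "moebius n = (if squarefree n then (- 1) ^ card (prime_factors n) else 0)"

text \<open>
  Commutative rings are types of sort \<open>{comm_ring, comm_monoid_mult}\<close>. This is
  \<open>comm_ring_1\<close> without the axiom \<open>0 \<noteq> 1\<close>, so the zero ring is allowed. Because
  \<open>of_nat\<close> is only available under that axiom, the natural multiple
  \<open>x + \<dots> + x\<close> is written with \<open>nat_mult\<close>.
\<close>

definition nat_mult :: "nat \<Rightarrow> 'a::comm_monoid_add \<Rightarrow> 'a" where
  "nat_mult n x = (((+) x) ^^ n) 0"

lemma nat_mult_eq_of_nat: "nat_mult n x = of_nat n * (x :: 'a::comm_ring_1)"
  by (induction n) (simp_all add: nat_mult_def algebra_simps)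

locale rat_algebra = vector_space scale
  for scale :: "rat \<Rightarrow> 'a::{comm_ring, comm_monoid_mult} \<Rightarrow> 'a" +
  assumes scale_mult_left: "scale c x * y = scale c (x * y)"

text \<open>
  An element \<open>(x\<^sub>1, x\<^sub>2, \<dots>)\<close> of the necklace ring is a function on \<open>nat\<close>, of which
  only the values at positive arguments are meaningful; entry \<open>0\<close> is junk and is
  never used to compute an entry at a positive index.
\<close>

type_synonym 'a necklace = "nat \<Rightarrow> 'a"

definition necklace_mult ::
    "'a::{comm_ring, comm_monoid_mult} necklace \<Rightarrow> 'a necklace \<Rightarrow> 'a necklace"
    (infixl \<open>\<cdot>\<^sub>N\<^sub>r\<close> 70) where
  "x \<cdot>\<^sub>N\<^sub>r y =
     (\<lambda>n. \<Sum>(i, j) \<in> {(i, j). i \<ge> 1 \<and> j \<ge> 1 \<and> lcm i j = n}. nat_mult (gcd i j) (x i * y j))"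

definition truncate ::
    "nat \<Rightarrow> 'a::{comm_ring, comm_monoid_mult} necklace \<Rightarrow> 'a necklace" where
  "truncate r x = (\<lambda>n. if n dvd r then x n else 0)"

text \<open>
  For \<open>n, r \<ge> 1\<close> the condition \<open>lcm j r = n * r\<close> implies \<open>n dvd j\<close>, so the division
  is exact.
\<close>

lemma frobenius_coeff_integral:
  fixes j n r :: nat
  assumes "r \<ge> 1" "lcm j r = n * r"
  shows "n dvd j"
proof -
  have "j * r = gcd j r * (n * r)"
    using prod_gcd_lcm_nat[of j r] unfolding assms(2) .
  then have "j * r = (n * gcd j r) * r" by (simp only: mult_ac)
  then have "j = n * gcd j r" using assms(1) by (simp only: mult_right_cancel)
  then show ?thesis by (rule dvdI)
qed

definition frobenius ::
    "nat \<Rightarrow> 'a::{comm_ring, comm_monoid_mult} necklace \<Rightarrow> 'a necklace" where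
  "frobenius r x = (\<lambda>n. \<Sum>j \<in> {j. j \<ge> 1 \<and> lcm j r = n * r}. nat_mult (j div n) (x j))"

end

theory Submission imports Defs
begin

text \<open>
  If \<open>a\<close> and \<open>c\<close> are coprime, the indices occurring in entry \<open>a\<close> of \<open>F\<^sub>c x\<close> are the \<open>a e\<close> with
  \<open>e dvd c\<close>, and their coefficients are \<open>e\<close>. On both sides one therefore sums over pairs
  \<open>(i, j) = (a\<^sub>1 e, b\<^sub>3 f)\<close>. The lcm of such a pair is \<open>a\<^sub>1 b\<^sub>3 m\<close> for a divisor \<open>m\<close> of \<open>a\<^sub>2\<close>, and the
  pair contributes to \<open>F\<^bsub>a\<^sub>3 d\<^esub> x\<close> and \<open>F\<^bsub>b\<^sub>1 d\<^esub> y\<close> exactly when \<open>m dvd d\<close>. Summing against the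
  Moebius function keeps the pairs with \<open>m = a\<^sub>2\<close>, that is with \<open>lcm i j = lcm r s\<close>, and for them
  \<open>e f = a\<^sub>2 gcd i j\<close>.
\<close>

section \<open>Moebius sums over divisors\<close>

lemma sum_moebius_divisors:
  fixes n :: nat
  assumes "n \<ge> 1"
  shows "(\<Sum>d | d dvd n. moebius d) = (if n = 1 then 1 else 0)"
proof (cases "n = 1")
  case True
  then show ?thesis by (simp add: moebius_def)
next
  case False
  with assms obtain p where p: "prime p" "p dvd n"
    using prime_factor_nat by blast
  \<comment> \<open>Multiplication by \<open>p\<close> pairs off the squarefree divisors with opposite signs.\<close>
  define A where "A = {d. d dvd n \<and> squarefree d \<and> \<not> p dvd d}"
  have fin: "finite {d. d dvd n}" using assms by simp
  have moebius_times: "moebius (p * d) = - moebius d" if "d \<in> A" for d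
  proof -
    from that have d: "squarefree d" "\<not> p dvd d" by (auto simp: A_def)
    then have "d \<noteq> 0" by (metis dvd_0_right)
    have "coprime p d" using p(1) d(2) by (simp add: prime_imp_coprime)
    then have "squarefree (p * d)"
      using d p(1) by (simp add: squarefree_mult_coprime squarefree_prime)
    moreover have "prime_factors (p * d) = insert p (prime_factors d)"
      using p(1) \<open>d \<noteq> 0\<close> by (simp add: prime_factors_product prime_factorization_prime)
    moreover have "p \<notin> prime_factors d" using d(2) by auto
    ultimately show ?thesis using d(1) by (simp add: moebius_def)
  qed
  have split: "{d. d dvd n \<and> squarefree d} = A \<union> (*) p ` A"
  proof (intro equalityI subsetI)
    fix d assume d: "d \<in> {d. d dvd n \<and> squarefree d}"
    show "d \<in> A \<union> (*) p ` A"
    proof (cases "p dvd d")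
      case True
      then obtain e where e: "d = p * e" ..
      have "\<not> p dvd e"
      proof
        assume "p dvd e"
        then have "p ^ 2 dvd d" using e by (simp add: power2_eq_square mult_dvd_mono)
        with d have "p dvd 1" by (auto dest: squarefreeD)
        with p(1) show False by simp
      qed
      moreover have "squarefree e" using d e squarefree_mono[of e d] by auto
      moreover have "e dvd n" using d e by (auto intro: dvd_mult_right)
      ultimately show ?thesis using e by (auto simp: A_def)
    qed (use d in \<open>auto simp: A_def\<close>)
  next
    fix d assume "d \<in> A \<union> (*) p ` A"
    then show "d \<in> {d. d dvd n \<and> squarefree d}"
    proof
      assume "d \<in> (*) p ` A"
      then obtain e where e: "d = p * e" "e dvd n" "squarefree e" "\<not> p dvd e"
        by (auto simp: A_def)
      then have "coprime p e" using p(1) by (simp add: prime_imp_coprime)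
      then show ?thesis using e p
        by (auto simp: squarefree_mult_coprime squarefree_prime divides_mult)
    qed (auto simp: A_def)
  qed
  have "(\<Sum>d | d dvd n. moebius d) = (\<Sum>d | d dvd n \<and> squarefree d. moebius d)"
    using fin by (intro sum.mono_neutral_right) (auto simp: moebius_def)
  also have "\<dots> = (\<Sum>d\<in>A. moebius d) + (\<Sum>d\<in>(*) p ` A. moebius d)"
    unfolding split
    by (rule sum.union_disjoint) (auto simp: A_def intro: finite_subset[OF _ fin])
  also have "(\<Sum>d\<in>(*) p ` A. moebius d) = (\<Sum>d\<in>A. moebius (p * d))"
    using p(1) by (subst sum.reindex) (auto simp: inj_on_def prime_gt_0_nat)
  also have "\<dots> = - (\<Sum>d\<in>A. moebius d)"
    by (simp add: moebius_times sum_negf)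
  finally show ?thesis using False by simp
qed

text \<open>With \<open>a = m * k\<close>, the map sending \<open>d\<close> to
  \<open>a div d\<close> is a bijection from the \<open>d\<close> with \<open>m dvd d\<close> and
  \<open>d dvd a\<close> to the divisors of \<open>k\<close>. What remains is the full Moebius sum
  of \<open>k\<close>, and \<open>k = 1\<close> means \<open>m = a\<close>.\<close>

lemma sum_moebius_interval:
  fixes a m :: nat
  assumes "a \<ge> 1" "m dvd a"
  shows "(\<Sum>d | d dvd a \<and> m dvd d. moebius (a div d)) = (if m = a then 1 else 0)"
proof -
  from assms obtain k where k: "a = m * k" by auto
  with assms have pos: "m > 0" "k > 0" by auto
  have "(\<Sum>d | d dvd a \<and> m dvd d. moebius (a div d)) = (\<Sum>d | d dvd k. moebius d)"
  proof (rule sum.reindex_bij_witness[where i = "\<lambda>d. a div d" and j = "\<lambda>d. a div d"])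
    fix d assume "d \<in> {d. d dvd a \<and> m dvd d}"
    then obtain e where e: "d = m * e" by auto
    with \<open>d \<in> _\<close> k pos obtain u where "k = e * u" by auto
    note e this
    then show "a div (a div d) = d" "a div d \<in> {d. d dvd k}"
      using k pos by (auto simp: mult.assoc)
  next
    fix d assume "d \<in> {d. d dvd k}"
    then obtain e where "k = d * e" by auto
    then show "a div (a div d) = d" "a div d \<in> {d. d dvd a \<and> m dvd d}"
      using k pos by (auto simp: ac_simps)
  qed simp
  also have "\<dots> = (if k = 1 then 1 else 0)"
    using pos by (intro sum_moebius_divisors) simp
  finally show ?thesis using k pos by auto
qed

section \<open>Entries of Frobenius images at coprime indices, and divisibility criteria\<close>

text \<open>An index \<open>j\<close> with \<open>lcm j c = a * c\<close> is a multiple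
  \<open>a * e\<close>, and coprimality turns \<open>lcm (a * e) c\<close> into
  \<open>a * lcm e c\<close>. The condition becomes \<open>lcm e c = c\<close>, that is
  \<open>e dvd c\<close>, and the coefficient \<open>j div a\<close> becomes
  \<open>e\<close>.\<close>

lemma frobenius_coprime:
  fixes a c :: nat
  assumes "a \<ge> 1" "c \<ge> 1" "coprime a c"
  shows "frobenius c x a = (\<Sum>e | e dvd c. nat_mult e (x (a * e)))"
proof -
  have lcm: "lcm (a * e) c = a * lcm e c" for e
  proof -
    have "gcd (a * e) c * lcm (a * e) c = a * (gcd e c * lcm e c)"
      by (simp add: prod_gcd_lcm_nat[symmetric] ac_simps)
    moreover have "gcd (a * e) c = gcd e c"
      using assms by (simp add: gcd_mult_left_left_cancel coprime_commute)
    ultimately have "gcd e c * lcm (a * e) c = gcd e c * (a * lcm e c)"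
      by (simp only: mult.left_commute)
    moreover have "gcd e c \<noteq> 0" using assms by simp
    ultimately show ?thesis using mult_left_cancel by blast
  qed
  have *: "lcm e c = c \<longleftrightarrow> e dvd c" for e by (metis dvd_lcm1 lcm_proj2_if_dvd_nat)
  have index_set: "{j. j \<ge> 1 \<and> lcm j c = a * c} = (*) a ` {e. e dvd c}"
  proof (intro equalityI subsetI)
    fix j assume j: "j \<in> {j. j \<ge> 1 \<and> lcm j c = a * c}"
    then have "a dvd j" using assms(2) frobenius_coeff_integral by blast
    then obtain e where e: "j = a * e" ..
    have "a * lcm e c = a * c" using j by (simp only: e lcm mem_Collect_eq)
    then have "e dvd c" using assms(1) * by simp
    then show "j \<in> (*) a ` {e. e dvd c}" using e by blast
  next
    fix j assume "j \<in> (*) a ` {e. e dvd c}"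
    then obtain e where e: "j = a * e" "e dvd c" by blast
    then have "e > 0" using assms(2) by (auto intro!: Nat.gr0I)
    then show "j \<in> {j. j \<ge> 1 \<and> lcm j c = a * c}" using assms(1) e * by (simp add: lcm)
  qed
  show ?thesis
    unfolding frobenius_def index_set using assms
    by (subst sum.reindex) (auto simp: inj_on_def)
qed

text \<open>For a prime \<open>p\<close> dividing \<open>a\<close>, the hypothesis on
  \<open>a div b\<close> makes the multiplicity of \<open>p\<close> in \<open>b\<close> strictly
  smaller than in \<open>a\<close>, and \<open>c\<close> contributes no factor \<open>p\<close>. So
  \<open>j\<close> cannot supply the power of \<open>p\<close> required in \<open>lcm i j\<close>,
  and \<open>i\<close> must.\<close>

lemma dvd_left_factor_of_dvd_lcm:
  fixes a b c i j :: nat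
  assumes "a \<ge> 1" "b dvd a" "\<And>p. prime p \<Longrightarrow> p dvd a \<Longrightarrow> p dvd a div b"
    and "coprime a c" "j dvd b * c" "a dvd lcm i j" "i > 0" "j > 0"
  shows "a dvd i"
proof (rule multiplicity_le_imp_dvd)
  fix p :: nat assume p: "prime p"
  show "multiplicity p a \<le> multiplicity p i"
  proof (cases "p dvd a")
    case True
    then have "p dvd a div b" using assms p by blast
    then have "b * p dvd a" using assms(1,2)
      by (metis dvd_div_mult_self mult.commute mult_dvd_mono dvd_refl)
    have "b > 0" using assms by (auto intro!: Nat.gr0I)
    have "coprime p c" using coprime_divisors[OF True dvd_refl assms(4)] .
    then have "\<not> p dvd c" using p coprime_common_divisor[of p c p] by (auto dest: not_prime_unit)
    then have "c > 0" by (auto intro: Nat.gr0I)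
    have "multiplicity p j \<le> multiplicity p (b * c)"
      using assms(5) \<open>b > 0\<close> \<open>c > 0\<close> by (intro dvd_imp_multiplicity_le) auto
    also have "\<dots> = multiplicity p b"
      using p \<open>b > 0\<close> \<open>c > 0\<close> \<open>\<not> p dvd c\<close>
      by (simp add: prime_elem_multiplicity_mult_distrib not_dvd_imp_multiplicity_0)
    also have "\<dots> < multiplicity p (b * p)"
      using p \<open>b > 0\<close> by (simp add: prime_elem_multiplicity_mult_distrib prime_gt_0_nat)
    also have "\<dots> \<le> multiplicity p a"
      using \<open>b * p dvd a\<close> assms by (intro dvd_imp_multiplicity_le) auto
    finally have "multiplicity p j < multiplicity p a" .
    moreover have "multiplicity p a \<le> multiplicity p (lcm i j)"
      using assms by (intro dvd_imp_multiplicity_le) auto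
    moreover have "multiplicity p (lcm i j) = max (multiplicity p i) (multiplicity p j)"
      using assms p by (simp add: count_prime_factorization_prime[symmetric] prime_factorization_lcm)
    ultimately show ?thesis by auto
  qed (simp add: not_dvd_imp_multiplicity_0)
qed (use assms in auto)

text \<open>With \<open>b = a * k\<close>, \<open>e\<close> divides
  \<open>a * gcd (k * d) c\<close>, and this gcd is \<open>d\<close> because \<open>k\<close> is
  coprime to \<open>c\<close> and \<open>d dvd c\<close>.\<close>

lemma dvd_mult_of_dvd_mult:
  fixes a b c d e :: nat
  assumes "a dvd b" "coprime b c" "d dvd c" "e dvd b * d" "e dvd a * c"
  shows "e dvd a * d"
proof -
  obtain k where k: "b = a * k" using assms by auto
  have "e dvd gcd (a * (k * d)) (a * c)" using assms k by (simp add: ac_simps)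
  also have "\<dots> = a * gcd (k * d) c" by (simp add: gcd_mult_distrib_nat)
  also have "gcd (k * d) c = gcd d c"
    using assms k by (intro gcd_mult_left_left_cancel) (auto simp: coprime_commute)
  also have "\<dots> = d" using assms by (simp add: gcd_proj1_iff)
  finally show ?thesis .
qed

section \<open>The product formula for given coprime factors\<close>

context rat_algebra
begin

lemma nat_mult_eq_scale: "nat_mult n x = scale (of_nat n) x"
  by (induction n) (simp_all add: nat_mult_def scale_left_distrib)

lemma scale_mult_scale: "scale c x * scale d y = scale (c * d) (x * y)"
  by (metis mult.commute scale_mult_left scale_scale)

text \<open>Prime factorizations enter only through coprimality and the conditions on
  \<open>a1 div b1\<close> and \<open>b3 div a3\<close>. Both sides are reduced to the same sum over
  the \<open>z\<close> in \<open>P\<close> with \<open>L z = a1 * a2 * b3\<close>.\<close>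

lemma necklace_mult_truncate_lcm:
  fixes a1 a2 a3 b1 b3 :: nat
  assumes pos: "a1 \<ge> 1" "a2 \<ge> 1" "b3 \<ge> 1"
    and cop: "coprime a1 a2" "coprime a1 b3" "coprime b3 a2"
    and b1: "b1 dvd a1" "\<And>p. prime p \<Longrightarrow> p dvd a1 \<Longrightarrow> p dvd a1 div b1"
    and a3: "a3 dvd b3" "\<And>p. prime p \<Longrightarrow> p dvd b3 \<Longrightarrow> p dvd b3 div a3"
  shows "(truncate (a1 * a2 * a3) x \<cdot>\<^sub>N\<^sub>r truncate (b1 * a2 * b3) y) (a1 * a2 * b3) =
    scale (1 / of_nat a2) (\<Sum>d | d dvd a2. scale (of_int (moebius (a2 div d)))
      (frobenius (a3 * d) x a1 * frobenius (b1 * d) y b3))"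
proof -
  have pos': "b1 \<ge> 1" "a3 \<ge> 1"
    using pos b1 a3 by (auto simp: Suc_le_eq intro!: Nat.gr0I)
  have cop': "coprime a1 a3" "coprime b3 b1"
    using coprime_divisors[OF dvd_refl a3(1) cop(2)] coprime_divisors[OF b1(1) dvd_refl cop(2)]
    by (simp_all add: coprime_commute)
  \<comment> \<open>A pair \<open>(e, f)\<close> encodes the indices \<open>a1 * e\<close> and
    \<open>b3 * f\<close>. \<open>P\<close> is the range belonging to \<open>d = a2\<close>; it
    contains the ranges for all other divisors \<open>d\<close> of \<open>a2\<close>.\<close>
  define P where "P = {e. e dvd a3 * a2} \<times> {f. f dvd b1 * a2}"
  define L where "L = (\<lambda>(e, f). lcm (a1 * e) (b3 * f))"
  define Z where "Z = (\<lambda>(e, f). x (a1 * e) * y (b3 * f))"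
  have finP: "finite P" using pos pos' by (auto simp: P_def)

  \<comment> \<open>The right side is the index condition for the two Frobenius entries. The left
    side expresses it through \<open>L z\<close> alone, which is what makes Moebius inversion
    applicable. Cancelling \<open>a1\<close> leaves only \<open>e dvd b3 * d\<close>; membership in
    \<open>P\<close> sharpens this to \<open>e dvd a3 * d\<close>, and likewise for
    \<open>f\<close>.\<close>
  have L_dvd: "L z dvd a1 * b3 * d \<longleftrightarrow> fst z dvd a3 * d \<and> snd z dvd b1 * d"
    if "z \<in> P" "d dvd a2" for z d
  proof -
    obtain e f where z: "z = (e, f)" by (cases z)
    have ef: "e dvd a3 * a2" "f dvd b1 * a2" using that z by (auto simp: P_def)
    have "a1 * e dvd a1 * b3 * d \<longleftrightarrow> e dvd a3 * d"
      using pos dvd_mult_of_dvd_mult[OF a3(1) cop(3) that(2) _ ef(1)]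
        dvd_trans[OF _ mult_dvd_mono[OF a3(1) dvd_refl]]
      by (auto simp: mult.assoc)
    moreover have "b3 * f dvd a1 * b3 * d \<longleftrightarrow> f dvd b1 * d"
      using pos dvd_mult_of_dvd_mult[OF b1(1) cop(1) that(2) _ ef(2)]
        dvd_trans[OF _ mult_dvd_mono[OF b1(1) dvd_refl]]
      by (auto simp: mult.assoc mult.left_commute[of a1])
    ultimately show ?thesis by (simp add: z L_def)
  qed

  \<comment> \<open>Since \<open>L z\<close> lies between \<open>a1 * b3\<close> and
    \<open>a1 * b3 * a2\<close> in divisibility, it is \<open>a1 * b3 * m\<close> with
    \<open>m dvd a2\<close>, and the condition on \<open>d\<close> reads
    \<open>m dvd d\<close>.\<close>
  have inner: "(\<Sum>d | d dvd a2 \<and> L z dvd a1 * b3 * d. moebius (a2 div d)) =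
      (if L z = a1 * a2 * b3 then 1 else 0)" if "z \<in> P" for z
  proof -
    have "a1 * b3 dvd L z"
      using cop(2) by (intro divides_mult) (auto simp: L_def split: prod.split intro: dvd_trans[OF _ dvd_lcm1] dvd_trans[OF _ dvd_lcm2])
    then obtain m where m: "L z = a1 * b3 * m" by auto
    have "L z dvd a1 * b3 * a2" using L_dvd[OF that dvd_refl] that by (auto simp: P_def)
    then have "m dvd a2" using m pos by simp
    then show ?thesis using sum_moebius_interval[of a2 m] pos by (auto simp: m)
  qed

  \<comment> \<open>The factor \<open>1 / of_nat a2\<close> arises here: cancelling
    \<open>a1 * b3\<close> in gcd times lcm equals product leaves
    \<open>e * f = gcd * a2\<close>.\<close>
  have coeff: "nat_mult (gcd (a1 * e) (b3 * f)) w = scale (1 / of_nat a2) (nat_mult (e * f) w)"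
    if "L (e, f) = a1 * a2 * b3" for e f w
  proof -
    have "(a1 * e) * (b3 * f) = gcd (a1 * e) (b3 * f) * (a1 * a2 * b3)"
      using that prod_gcd_lcm_nat[of "a1 * e" "b3 * f"] by (simp add: L_def)
    then have "(a1 * b3) * (e * f) = (a1 * b3) * (gcd (a1 * e) (b3 * f) * a2)"
      by (simp only: ac_simps)
    then have ef: "e * f = gcd (a1 * e) (b3 * f) * a2" using pos by simp
    show ?thesis unfolding nat_mult_eq_scale ef using pos by simp
  qed

  have prod_frob: "frobenius (a3 * d) x a1 * frobenius (b1 * d) y b3 =
      (\<Sum>z | z \<in> P \<and> L z dvd a1 * b3 * d. nat_mult (fst z * snd z) (Z z))"
    if d: "d dvd a2" for d
  proof -
    have "d > 0" using d pos by (auto intro!: Nat.gr0I)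
    moreover have "coprime a1 d" "coprime b3 d"
      using coprime_divisors[OF dvd_refl d] cop by blast+
    ultimately have "frobenius (a3 * d) x a1 * frobenius (b1 * d) y b3 =
        (\<Sum>e | e dvd a3 * d. nat_mult e (x (a1 * e))) * (\<Sum>f | f dvd b1 * d. nat_mult f (y (b3 * f)))"
      using pos pos' cop' by (simp add: frobenius_coprime)
    also have "\<dots> = (\<Sum>z \<in> {e. e dvd a3 * d} \<times> {f. f dvd b1 * d}. nat_mult (fst z * snd z) (Z z))"
      by (simp add: sum_product sum.cartesian_product nat_mult_eq_scale scale_mult_scale Z_def
        case_prod_unfold)
    also have "{e. e dvd a3 * d} \<times> {f. f dvd b1 * d} = {z. z \<in> P \<and> L z dvd a1 * b3 * d}"
    proof -
      have "e dvd k * a2" if "e dvd k * d" for e k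
        using that mult_dvd_mono[OF dvd_refl d] by (rule dvd_trans)
      then show ?thesis using L_dvd[OF _ d] by (force simp: P_def)
    qed
    finally show ?thesis .
  qed

  have "(\<Sum>d | d dvd a2. scale (of_int (moebius (a2 div d)))
      (frobenius (a3 * d) x a1 * frobenius (b1 * d) y b3)) =
    (\<Sum>d | d dvd a2. \<Sum>z | z \<in> P \<and> L z dvd a1 * b3 * d.
      scale (of_int (moebius (a2 div d))) (nat_mult (fst z * snd z) (Z z)))"
    by (simp add: prod_frob scale_sum_right)
  \<comment> \<open>Exchanging the sums isolates, for each pair, the Moebius sum that
    \<open>inner\<close> evaluates to an indicator.\<close>
  also have "\<dots> = (\<Sum>z\<in>P. \<Sum>d | d dvd a2 \<and> L z dvd a1 * b3 * d.
      scale (of_int (moebius (a2 div d))) (nat_mult (fst z * snd z) (Z z)))"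
    using sum.swap_restrict[of "{d. d dvd a2}" P] finP pos by simp
  also have "\<dots> = (\<Sum>z\<in>P. scale (of_int (\<Sum>d | d dvd a2 \<and> L z dvd a1 * b3 * d. moebius (a2 div d)))
      (nat_mult (fst z * snd z) (Z z)))"
    by (simp add: scale_sum_left)
  also have "\<dots> = (\<Sum>z\<in>P. if L z = a1 * a2 * b3 then nat_mult (fst z * snd z) (Z z) else 0)"
    by (rule sum.cong) (auto simp: inner)
  also have "\<dots> = (\<Sum>z | z \<in> P \<and> L z = a1 * a2 * b3. nat_mult (fst z * snd z) (Z z))"
    using finP by (rule sum.inter_filter[symmetric])
  finally have rhs: "scale (1 / of_nat a2) (\<Sum>d | d dvd a2. scale (of_int (moebius (a2 div d)))
      (frobenius (a3 * d) x a1 * frobenius (b1 * d) y b3)) =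
    (\<Sum>z | z \<in> P \<and> L z = a1 * a2 * b3.
      scale (1 / of_nat a2) (nat_mult (fst z * snd z) (Z z)))"
    by (simp add: scale_sum_right)

  \<comment> \<open>\<open>I\<close> holds all index pairs of the necklace product at this entry,
    \<open>J\<close> those that survive both truncations.\<close>
  define I where "I = {(i, j). i \<ge> 1 \<and> j \<ge> 1 \<and> lcm i j = a1 * a2 * b3}"
  define J where "J = {(i, j). i \<ge> 1 \<and> j \<ge> 1 \<and> i dvd a1 * a2 * a3 \<and> j dvd b1 * a2 * b3 \<and>
    lcm i j = a1 * a2 * b3}"
  have "I \<subseteq> {i. i dvd a1 * a2 * b3} \<times> {j. j dvd a1 * a2 * b3}"
    by (auto simp: I_def) (metis dvd_lcm1 dvd_lcm2)+
  then have finI: "finite I"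
    using pos by (rule_tac finite_subset) auto
  have J_eq: "J = (\<lambda>(e, f). (a1 * e, b3 * f)) ` {z. z \<in> P \<and> L z = a1 * a2 * b3}"
  proof (intro equalityI subsetI)
    fix z assume "z \<in> J"
    then obtain i j where z: "z = (i, j)" and ij: "i \<ge> 1" "j \<ge> 1" "i dvd a1 * a2 * a3"
      "j dvd b1 * a2 * b3" "lcm i j = a1 * a2 * b3" by (auto simp: J_def)
    \<comment> \<open>At primes of \<open>a1\<close>, \<open>j\<close> contains at most the power in
      \<open>b1\<close>, so \<open>i\<close> carries the full power. The argument for
      \<open>b3\<close> exchanges the roles of \<open>i\<close> and \<open>j\<close>.\<close>
    have "a1 dvd i"
    proof (rule dvd_left_factor_of_dvd_lcm[OF pos(1) b1])
      show "coprime a1 (a2 * b3)" using cop by simp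
      show "j dvd b1 * (a2 * b3)" using ij(4) by (simp only: mult.assoc)
      show "a1 dvd lcm i j" unfolding ij(5) by (simp add: mult.assoc)
    qed (use ij in auto)
    moreover have "b3 dvd j"
    proof (rule dvd_left_factor_of_dvd_lcm[OF pos(3) a3])
      show "coprime b3 (a1 * a2)" using cop by (simp add: coprime_commute)
      show "i dvd a3 * (a1 * a2)" using ij(3) by (simp only: ac_simps)
      show "b3 dvd lcm j i" unfolding lcm.commute[of j] ij(5) by simp
    qed (use ij in auto)
    ultimately obtain e f where "i = a1 * e" "j = b3 * f" by (auto elim!: dvdE)
    then show "z \<in> (\<lambda>(e, f). (a1 * e, b3 * f)) ` {z. z \<in> P \<and> L z = a1 * a2 * b3}"
      using z ij pos by (auto simp: P_def L_def ac_simps intro!: image_eqI[of _ _ "(e, f)"])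
  next
    fix z assume "z \<in> (\<lambda>(e, f). (a1 * e, b3 * f)) ` {z. z \<in> P \<and> L z = a1 * a2 * b3}"
    then obtain e f where "z = (a1 * e, b3 * f)" "e dvd a3 * a2" "f dvd b1 * a2"
      "lcm (a1 * e) (b3 * f) = a1 * a2 * b3" by (auto simp: P_def L_def)
    moreover from this have "e > 0" "f > 0" using pos pos' by (auto intro!: Nat.gr0I)
    ultimately show "z \<in> J" using pos by (auto simp: J_def ac_simps)
  qed
  have "(truncate (a1 * a2 * a3) x \<cdot>\<^sub>N\<^sub>r truncate (b1 * a2 * b3) y) (a1 * a2 * b3) =
      (\<Sum>(i, j)\<in>I. nat_mult (gcd i j)
        (truncate (a1 * a2 * a3) x i * truncate (b1 * a2 * b3) y j))"
    by (simp add: necklace_mult_def I_def)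
  also have "\<dots> = (\<Sum>(i, j)\<in>J. nat_mult (gcd i j) (x i * y j))"
    using finI
    by (intro sum.mono_neutral_cong_right) (auto simp: I_def J_def truncate_def nat_mult_eq_scale split: if_splits)
  also have "\<dots> = (\<Sum>(e, f) | (e, f) \<in> P \<and> L (e, f) = a1 * a2 * b3.
      nat_mult (gcd (a1 * e) (b3 * f)) (x (a1 * e) * y (b3 * f)))"
    unfolding J_eq using pos
    by (subst sum.reindex) (auto simp: inj_on_def case_prod_unfold)
  also have "\<dots> = (\<Sum>z | z \<in> P \<and> L z = a1 * a2 * b3.
      scale (1 / of_nat a2) (nat_mult (fst z * snd z) (Z z)))"
    by (rule sum.cong) (auto simp: coeff Z_def)
  finally show ?thesis by (simp only: rhs)
qed

end

section \<open>Products of powers of distinct primes\<close>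

text \<open>Disjoint index sets give distinct primes by injectivity. The exponents \<open>k\<close>
  and \<open>l\<close> are independent so that mixed pairs such as \<open>a1\<close> and
  \<open>b3\<close> are covered too.\<close>

lemma coprime_prod_prime_powers:
  fixes p k l :: "'b \<Rightarrow> nat"
  assumes "\<And>i. i \<in> I \<Longrightarrow> prime (p i)" "inj_on p I" "A \<subseteq> I" "B \<subseteq> I" "A \<inter> B = {}"
  shows "coprime (\<Prod>i\<in>A. p i ^ k i) (\<Prod>i\<in>B. p i ^ l i)"
proof (intro prod_coprime_left prod_coprime_right)
  fix i j assume "i \<in> A" "j \<in> B"
  then have "i \<in> I" "j \<in> I" "i \<noteq> j" using assms by auto
  then have "coprime (p i) (p j)" using assms by (intro primes_coprime) (auto dest: inj_onD)
  then show "coprime (p i ^ k i) (p j ^ l j)" by simp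
qed

lemma prime_factors_prod_prime_powers:
  fixes p k :: "'b \<Rightarrow> nat"
  assumes "finite A" "\<And>i. i \<in> A \<Longrightarrow> prime (p i)" "\<And>i. i \<in> A \<Longrightarrow> k i > 0"
  shows "prime_factors (\<Prod>i\<in>A. p i ^ k i) = p ` A"
  using assms
proof (induction A)
  case (insert i A)
  have "l = p i" if "prime l" "l dvd p i ^ k i" for l
    using insert.prems that by (metis insertI1 prime_dvd_power primes_dvd_imp_eq)
  with insert.prems have "prime_factors (p i ^ k i) = {p i}"
    by (auto simp: prime_factors_dvd prime_gt_0_nat)
  moreover have "p i ^ k i \<noteq> 0" "(\<Prod>i\<in>A. p i ^ k i) \<noteq> 0"
    using insert by (auto simp: prime_gt_0_nat)
  ultimately show ?case using insert by (simp add: prime_factors_product)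
qed simp

lemma prod_prime_powers_quotient:
  fixes p k l :: "'b \<Rightarrow> nat"
  assumes "finite A" "\<And>i. i \<in> A \<Longrightarrow> prime (p i)" "\<And>i. i \<in> A \<Longrightarrow> l i < k i"
  shows "(\<Prod>i\<in>A. p i ^ l i) dvd (\<Prod>i\<in>A. p i ^ k i)"
    and "prime_factors (\<Prod>i\<in>A. p i ^ k i) =
      prime_factors ((\<Prod>i\<in>A. p i ^ k i) div (\<Prod>i\<in>A. p i ^ l i))"
proof -
  have eq: "(\<Prod>i\<in>A. p i ^ k i) = (\<Prod>i\<in>A. p i ^ l i) * (\<Prod>i\<in>A. p i ^ (k i - l i))"
    using assms by (auto simp: prod.distrib[symmetric] power_add[symmetric] intro!: prod.cong)
      (metis le_add_diff_inverse less_imp_le)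
  then show "(\<Prod>i\<in>A. p i ^ l i) dvd (\<Prod>i\<in>A. p i ^ k i)" by simp
  have "(\<Prod>i\<in>A. p i ^ l i) \<noteq> 0" using assms by (auto simp: prime_gt_0_nat)
  then have "(\<Prod>i\<in>A. p i ^ k i) div (\<Prod>i\<in>A. p i ^ l i) = (\<Prod>i\<in>A. p i ^ (k i - l i))"
    by (subst eq) simp
  then show "prime_factors (\<Prod>i\<in>A. p i ^ k i) =
      prime_factors ((\<Prod>i\<in>A. p i ^ k i) div (\<Prod>i\<in>A. p i ^ l i))"
    using assms prime_factors_prod_prime_powers[of A p k]
      prime_factors_prod_prime_powers[of A p "\<lambda>i. k i - l i"] by force
qed

section \<open>Sorting the primes by comparing their exponents in \<open>r\<close> and
  \<open>s\<close>\<close>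

theorem theorem3p38:
  fixes q r s a1 a2 a3 b1 b2 b3 :: nat and p re se :: "nat \<Rightarrow> nat"
  assumes "r \<ge> 1" and "s \<ge> 1"
    and "\<And>i. i \<in> {1..q} \<Longrightarrow> prime (p i)" and "inj_on p {1..q}"
    and "r = (\<Prod>i = 1..q. p i ^ re i)" and "s = (\<Prod>i = 1..q. p i ^ se i)"
    and "a1 = (\<Prod>i \<in> {i \<in> {1..q}. re i > se i}. p i ^ re i)"
    and "a2 = (\<Prod>i \<in> {i \<in> {1..q}. re i = se i}. p i ^ re i)"
    and "a3 = (\<Prod>i \<in> {i \<in> {1..q}. re i < se i}. p i ^ re i)"
    and "b1 = (\<Prod>i \<in> {i \<in> {1..q}. re i > se i}. p i ^ se i)"
    and "b2 = (\<Prod>i \<in> {i \<in> {1..q}. re i = se i}. p i ^ se i)"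
    and "b3 = (\<Prod>i \<in> {i \<in> {1..q}. re i < se i}. p i ^ se i)"
  shows "r = a1 * a2 * a3 \<and> s = b1 * b2 * b3 \<and>
    gcd a1 a2 = 1 \<and> gcd a2 a3 = 1 \<and> gcd a3 a1 = 1 \<and>
    gcd b1 b2 = 1 \<and> gcd b2 b3 = 1 \<and> gcd b3 b1 = 1 \<and>
    b1 dvd a1 \<and> prime_factors a1 = prime_factors (a1 div b1) \<and>
    a2 = b2 \<and>
    a3 dvd b3 \<and> prime_factors b3 = prime_factors (b3 div a3) \<and>
    (\<forall>(scale :: rat \<Rightarrow> 'a::{comm_ring, comm_monoid_mult} \<Rightarrow> 'a) (x :: 'a necklace) (y :: 'a necklace).
      rat_algebra scale \<longrightarrow>
        (truncate r x \<cdot>\<^sub>N\<^sub>r truncate s y) (lcm r s) =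
          scale (1 / of_nat a2)
            (\<Sum>d2 \<in> {d2. d2 dvd a2}.
              scale (of_int (moebius (a2 div d2)))
                (frobenius (a3 * d2) x a1 * frobenius (b1 * d2) y b3)) \<and>
        (a2 = 1 \<and> b2 = 1 \<longrightarrow>
          (truncate r x \<cdot>\<^sub>N\<^sub>r truncate s y) (lcm r s) =
            frobenius a3 x a1 * frobenius b1 y b3))"
proof -
  define A where "A = {i \<in> {1..q}. re i > se i}"
  define B where "B = {i \<in> {1..q}. re i = se i}"
  define C where "C = {i \<in> {1..q}. re i < se i}"
  note defs = assms(7-12)[folded A_def B_def C_def]
  have sub: "A \<subseteq> {1..q}" "B \<subseteq> {1..q}" "C \<subseteq> {1..q}" by (auto simp: A_def B_def C_def)
  have disj: "A \<inter> B = {}" "B \<inter> C = {}" "C \<inter> A = {}" "A \<inter> C = {}" "C \<inter> B = {}"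
    by (auto simp: A_def B_def C_def)
  have fin: "finite A" "finite B" "finite C" using sub finite_subset by blast+
  have part: "(\<Prod>i = 1..q. g i) = prod g A * prod g B * prod g C" for g :: "nat \<Rightarrow> nat"
  proof -
    have "{1..q} = (A \<union> B) \<union> C" by (auto simp: A_def B_def C_def)
    moreover have "(A \<union> B) \<inter> C = {}" using disj by auto
    ultimately show ?thesis using fin disj by (simp add: prod.union_disjoint)
  qed
  note cop = coprime_prod_prime_powers[where I = "{1..q}" and p = p, OF assms(3,4)]
  have r: "r = a1 * a2 * a3" and s: "s = b1 * b2 * b3"
    unfolding assms(5,6) defs by (rule part)+
  have ab: "a2 = b2" unfolding defs by (rule prod.cong) (auto simp: B_def)
  have cop_a: "coprime a1 a2" "coprime a2 a3" "coprime a3 a1"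
    and cop_b: "coprime b1 b2" "coprime b2 b3" "coprime b3 b1" and "coprime a1 b3"
    unfolding defs using sub disj by (auto intro!: cop)
  have prime: "\<And>i. i \<in> A \<Longrightarrow> prime (p i)" "\<And>i. i \<in> C \<Longrightarrow> prime (p i)"
    using assms(3) sub by blast+
  have a1: "b1 dvd a1" "prime_factors a1 = prime_factors (a1 div b1)"
    unfolding defs using prime
    by (intro prod_prime_powers_quotient[OF fin(1)]; simp add: A_def)+
  have b3: "a3 dvd b3" "prime_factors b3 = prime_factors (b3 div a3)"
    unfolding defs using prime
    by (intro prod_prime_powers_quotient[OF fin(3)]; simp add: C_def)+
  have pos: "a1 > 0" "a2 > 0" "b3 > 0" using assms(1,2) r s by (auto intro!: Nat.gr0I)
  \<comment> \<open>This turns equality of the sets of prime factors into the primewise hypothesis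
    of the product formula.\<close>
  have pf: "l dvd m div n" if "prime_factors m = prime_factors (m div n)" "m > 0" "prime l" "l dvd m"
    for l m n :: nat
  proof -
    have "l \<in> prime_factors m" using that by (auto intro: prime_factorsI)
    then show ?thesis unfolding that(1) by auto
  qed
  \<comment> \<open>The larger exponent wins in each class of primes: that of \<open>r\<close> in
    \<open>a1\<close>, the common one in \<open>a2\<close>, that of \<open>s\<close> in
    \<open>b3\<close>.\<close>
  have lcm: "lcm r s = a1 * a2 * b3"
  proof (rule dvd_antisym)
    show "lcm r s dvd a1 * a2 * b3"
      unfolding r s ab using a1(1) b3(1) by (auto intro!: lcm_least mult_dvd_mono)
    have "a1 dvd lcm r s" "a2 dvd lcm r s" "b3 dvd lcm r s"
      using r s by (auto intro: dvd_trans[OF _ dvd_lcm1] dvd_trans[OF _ dvd_lcm2])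
    then show "a1 * a2 * b3 dvd lcm r s"
      using cop_a cop_b ab \<open>coprime a1 b3\<close> by (intro divides_mult) auto
  qed
  have main: "(truncate r x \<cdot>\<^sub>N\<^sub>r truncate s y) (lcm r s) =
      scale (1 / of_nat a2) (\<Sum>d | d dvd a2. scale (of_int (moebius (a2 div d)))
        (frobenius (a3 * d) x a1 * frobenius (b1 * d) y b3))"
    if "rat_algebra scale" for scale :: "rat \<Rightarrow> 'a \<Rightarrow> 'a" and x y :: "'a necklace"
    unfolding lcm unfolding r s ab[symmetric]
    using pos cop_a cop_b ab \<open>coprime a1 b3\<close> a1 b3 pf
    by (intro rat_algebra.necklace_mult_truncate_lcm[OF that]) (auto simp: coprime_commute)
  have main1: "(truncate r x \<cdot>\<^sub>N\<^sub>r truncate s y) (lcm r s) = frobenius a3 x a1 * frobenius b1 y b3"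
    if alg: "rat_algebra scale" and "a2 = 1"
    for scale :: "rat \<Rightarrow> 'a \<Rightarrow> 'a" and x y :: "'a necklace"
  proof -
    \<comment> \<open>For \<open>a2 = 1\<close> only \<open>d = 1\<close> occurs, with Moebius value
      1; the interpretation supplies that scaling by 1 is the identity.\<close>
    interpret rat_algebra scale by (fact alg)
    show ?thesis using main[OF alg, of x y] \<open>a2 = 1\<close> by (simp add: moebius_def)
  qed
  show ?thesis
    using r s ab cop_a cop_b a1 b3 main main1 by (simp add: coprime_iff_gcd_eq_1)
qed

end
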